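(* Let $m = 37q$, where $q = -q_1\cdots q_n$ with $q_1,\dots,q_n$ distinct primes satisfying $\left(\frac{q_j}{37}\right)=1$ for all $j$, and $q\equiv 1 \pmod 8$. Then over the imaginary quadratic field $K=\mathbb{Q}(\sqrt{m})$ there exists an elliptic curve $E/K$ with everywhere good reduction; moreover such an $E$ can be chosen with $j(E)=16^3$.
   Context: $\left(\frac{a}{p}\right)$ denotes the Legendre symbol. An elliptic curve $E/K$ has everywhere good reduction if it has good reduction at every prime of $\mathcal{O}_K$. *)

theory Defs
  imports Complex_Main "HOL-Computational_Algebra.Polynomial" "HOL-Number_Theory.Number_Theory"
begin

definition quad_field :: "int \<Rightarrow> complex set" where
  "quad_field m = {of_rat a + of_rat b * csqrt (of_int m) | a b. True}"

definition ring_of_integers :: "complex set \<Rightarrow> complex set" where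
  "ring_of_integers K = {x \<in> K. algebraic_int x}"

definition prime_of :: "complex set \<Rightarrow> complex set \<Rightarrow> bool" where
  "prime_of K P \<longleftrightarrow> (let OK = ring_of_integers K in
     P \<subseteq> OK \<and> 0 \<in> P \<and> (\<forall>x\<in>P. \<forall>y\<in>P. x + y \<in> P) \<and> (\<forall>x\<in>P. - x \<in> P)
     \<and> (\<forall>a\<in>OK. \<forall>x\<in>P. a * x \<in> P) \<and> P \<noteq> {0} \<and> 1 \<notin> P
     \<and> (\<forall>x\<in>OK. \<forall>y\<in>OK. x * y \<in> P \<longrightarrow> x \<in> P \<or> y \<in> P))"

definition local_ring :: "complex set \<Rightarrow> complex set \<Rightarrow> complex set" where
  "local_ring K P = {x \<in> K. \<exists>d \<in> ring_of_integers K - P. d * x \<in> ring_of_integers K}"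

definition local_unit :: "complex set \<Rightarrow> complex set \<Rightarrow> complex \<Rightarrow> bool" where
  "local_unit K P x \<longleftrightarrow> x \<noteq> 0 \<and> x \<in> local_ring K P \<and> inverse x \<in> local_ring K P"

text \<open>Long Weierstrass equation y^2 + a1 xy + a3 y = x^3 + a2 x^2 + a4 x + a6;
  coefficients are stored as a 5-tuple (a1,a2,a3,a4,a6).\<close>
type_synonym weier = "complex \<times> complex \<times> complex \<times> complex \<times> complex"

fun disc :: "weier \<Rightarrow> complex" where
  "disc (a1, a2, a3, a4, a6) =
    (let b2 = a1^2 + 4*a2; b4 = 2*a4 + a1*a3; b6 = a3^2 + 4*a6;
         b8 = a1^2*a6 + 4*a2*a6 - a1*a3*a4 + a2*a3^2 - a4^2
     in - (b2^2*b8) - 8*b4^3 - 27*b6^2 + 9*b2*b4*b6)"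

fun c4 :: "weier \<Rightarrow> complex" where
  "c4 (a1, a2, a3, a4, a6) =
    (let b2 = a1^2 + 4*a2; b4 = 2*a4 + a1*a3 in b2^2 - 24*b4)"

definition j_inv :: "weier \<Rightarrow> complex" where
  "j_inv E = c4 E ^ 3 / disc E"

fun elliptic_over :: "complex set \<Rightarrow> weier \<Rightarrow> bool" where
  "elliptic_over K (a1, a2, a3, a4, a6) \<longleftrightarrow>
     a1 \<in> K \<and> a2 \<in> K \<and> a3 \<in> K \<and> a4 \<in> K \<and> a6 \<in> K \<and> disc (a1, a2, a3, a4, a6) \<noteq> 0"

text \<open>Standard change of variables x = u^2 x' + r, y = u^3 y' + s u^2 x' + t.\<close>
fun change_coords :: "complex \<Rightarrow> complex \<Rightarrow> complex \<Rightarrow> complex \<Rightarrow> weier \<Rightarrow> weier" where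
  "change_coords u r s t (a1, a2, a3, a4, a6) =
    ((a1 + 2*s) / u,
     (a2 - s*a1 + 3*r - s^2) / u^2,
     (a3 + r*a1 + 2*t) / u^3,
     (a4 - s*a3 + 2*r*a2 - (t + r*s)*a1 + 3*r^2 - 2*s*t) / u^4,
     (a6 + r*a4 + r^2*a2 + r^3 - t*a3 - t^2 - r*t*a1) / u^6)"

definition good_reduction_at :: "complex set \<Rightarrow> complex set \<Rightarrow> weier \<Rightarrow> bool" where
  "good_reduction_at K P E \<longleftrightarrow>
    (\<exists>u r s t. u \<in> K \<and> u \<noteq> 0 \<and> r \<in> K \<and> s \<in> K \<and> t \<in> K \<and>
      (case change_coords u r s t E of (b1, b2, b3, b4, b6) \<Rightarrow>
         b1 \<in> local_ring K P \<and> b2 \<in> local_ring K P \<and> b3 \<in> local_ring K P \<and>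
         b4 \<in> local_ring K P \<and> b6 \<in> local_ring K P \<and>
         local_unit K P (disc (b1, b2, b3, b4, b6))))"

definition everywhere_good_reduction :: "complex set \<Rightarrow> weier \<Rightarrow> bool" where
  "everywhere_good_reduction K E \<longleftrightarrow> (\<forall>P. prime_of K P \<longrightarrow> good_reduction_at K P E)"

end

theory Submission
  imports Defs "HOL-Computational_Algebra.Squarefree"
begin

text \<open>
  The curve is a quadratic twist: $E_D : y^2 = x^3 + D x^2 - 12 D^2 x - \frac{67}{4} D^3$ has
  $c_4 = 2^4 \cdot 37 D^2$ and discriminant $37^3 D^6$, hence $j = 16^3$ for every $D$. It has good
  reduction at a prime away from $2 \cdot 37$ as soon as $D$ is a unit times a square there, at the
  ramified prime above $37$ if $D$ has odd valuation, and above $2$ if $D$ is a unit that is a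
  square modulo $4$. So one needs $D \in \mathcal{O}_K$ with $(D) = \mathfrak{p}_{37}\mathfrak{a}^2$
  and a condition modulo $4$. Legendre's theorem gives a primitive solution of
  $37 x^2 - q y^2 = z^2$; then $D = 37 x + y \sqrt{m}$ has norm $37 z^2$, and primitivity makes its
  ideal $\mathfrak{p}_{37}$ times a square away from $2$. The condition modulo $4$ holds for one of
  $\pm D$, after division by $2$ when $x$ and $y$ are both odd.
\<close>

section \<open>Legendre's theorem on ternary quadratic forms\<close>

lemma cong_int_obtain:
  fixes a b n :: int
  assumes "[a = b] (mod n)"
  obtains k where "a = n * k + b"
proof -
  obtain k where "a - b = n * k" using assms by (auto simp: cong_iff_dvd_diff)
  then show thesis using that[of k] by simp
qed

text \<open>Serves to choose between \<open>D\<close> and \<open>- D\<close>: negation exchanges the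
  residues 1 and 3 modulo 4.\<close>

lemma odd_cong_mod_4:
  fixes a :: int
  assumes "odd a"
  shows "[a = 1] (mod 4) \<or> [- a = 1] (mod 4)" "[a = 3] (mod 4) \<or> [- a = 3] (mod 4)"
  using assms unfolding cong_def by presburger+

text \<open>Distinct primes are coprime, so square roots modulo each of them glue by the Chinese
  remainder theorem.\<close>

lemma QuadRes_prod_modulus:
  fixes S :: "int set"
  assumes "finite S" "\<forall>p\<in>S. prime p" "\<forall>p\<in>S. QuadRes p a"
  shows "QuadRes (\<Prod>p\<in>S. p) a"
  using assms
proof (induction S rule: finite_induct)
  case empty
  then show ?case by (simp add: QuadRes_def)
next
  case (insert p S)
  obtain u where u: "[u^2 = a] (mod p)" using insert by (auto simp: QuadRes_def)
  obtain v where v: "[v^2 = a] (mod (\<Prod>p\<in>S. p))" using insert by (auto simp: QuadRes_def)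
  have cop: "coprime p (\<Prod>p\<in>S. p)"
    using insert by (intro prod_coprime_right) (auto intro: primes_coprime)
  obtain x where x: "[x = u] (mod p)" "[x = v] (mod (\<Prod>p\<in>S. p))"
    using binary_chinese_remainder_int[OF cop] by blast
  have "[x^2 = a] (mod p)" "[x^2 = a] (mod (\<Prod>p\<in>S. p))"
    using x u v by (meson cong_pow cong_trans)+
  then have "[x^2 = a] (mod (p * (\<Prod>p\<in>S. p)))"
    using cop by (rule coprime_cong_mult)
  then show ?case using insert by (auto simp: QuadRes_def)
qed

lemma QuadRes_prod:
  assumes "finite S" "\<forall>a\<in>S. QuadRes p (f a)"
  shows "QuadRes p (\<Prod>a\<in>S. f a)"
  using assms
proof (induction S rule: finite_induct)
  case empty
  then show ?case by (auto simp: QuadRes_def intro: exI[of _ 1])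
next
  case (insert a S)
  obtain u v where "[u^2 = f a] (mod p)" "[v^2 = (\<Prod>a\<in>S. f a)] (mod p)"
    using insert by (auto simp: QuadRes_def)
  then have "[(u*v)^2 = f a * (\<Prod>a\<in>S. f a)] (mod p)"
    unfolding power_mult_distrib by (rule cong_mult)
  then show ?case using insert by (auto simp: QuadRes_def)
qed

lemma squarefree_prod_primes_int:
  fixes S :: "int set"
  assumes "finite S" "\<forall>p\<in>S. prime p"
  shows "squarefree (\<Prod>p\<in>S. p)"
  using assms by (intro squarefree_prod_coprime) (auto intro: primes_coprime squarefree_prime)

lemma int_sqrt_exists:
  fixes n :: int
  assumes "n > 0"
  obtains k where "k \<ge> 0" "k^2 \<le> n" "n < (k+1)^2"
proof
  let ?k = "\<lfloor>sqrt n\<rfloor>"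
  show k: "?k \<ge> 0" using assms by simp
  have "real_of_int ?k ^ 2 \<le> sqrt n ^ 2"
    using k by (intro power_mono) auto
  then have "real_of_int (?k^2) \<le> n" using assms by simp
  then show "?k^2 \<le> n" by linarith
  have "sqrt n ^ 2 < (real_of_int ?k + 1)^2"
    using assms by (intro power_strict_mono) (auto simp: )
  then have "n < real_of_int ((?k+1)^2)" using assms by simp
  then show "n < (?k+1)^2" by linarith
qed

text \<open>Pigeonhole on a box. If \<open>c^2 = a\<close> modulo \<open>b\<close> and
  \<open>d^2 = b\<close> modulo \<open>a\<close>, then \<open>z = c * x\<close> modulo
  \<open>b\<close> and \<open>z = d * y\<close> modulo \<open>a\<close> together force
  \<open>a * b\<close> to divide \<open>a * x^2 + b * y^2 - z^2\<close>. Two points of the box agree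
  in both congruences; their difference makes the form so small that only the values 0 and
  \<open>a * b\<close> remain.\<close>

theorem Legendre_ternary:
  fixes a b :: int
  assumes pos: "a > 0" "b > 0" and cop: "coprime a b"
    and nsq: "\<And>k. k^2 \<noteq> a * b"
    and qr: "QuadRes a b" "QuadRes b a"
  obtains x y z where "a * x^2 + b * y^2 = z^2" "(x, y) \<noteq> (0, 0)"
proof -
  obtain d where d: "[d^2 = b] (mod a)" using qr by (auto simp: QuadRes_def)
  obtain c where c: "[c^2 = a] (mod b)" using qr by (auto simp: QuadRes_def)
  obtain k where k: "k \<ge> 0" "k^2 \<le> b" "b < (k+1)^2" using int_sqrt_exists pos by blast
  obtain l where l: "l \<ge> 0" "l^2 \<le> a" "a < (l+1)^2" using int_sqrt_exists pos by blast
  have ab: "a * b > 0" using pos by simp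
  obtain n where n: "n \<ge> 0" "n^2 \<le> a * b" "a * b < (n+1)^2" using int_sqrt_exists ab by blast
  \<comment> \<open>\<open>k\<close>, \<open>l\<close>, \<open>n\<close> are the integer parts of
    the square roots of \<open>b\<close>, \<open>a\<close>, \<open>a * b\<close>. The product of the
    squares of \<open>k+1\<close>, \<open>l+1\<close>, \<open>n+1\<close> exceeds
    \<open>(a * b)^2\<close>, so the box has more points than there are pairs of residues.\<close>
  define B where "B = {0..k} \<times> {0..l} \<times> {0..n}"
  define f where "f = (\<lambda>(x, y, z). ((z - c * x) mod b, (z - d * y) mod a))"
  have "a * b * (a * b) < (b * a) * (n+1)^2"
    using mult_strict_left_mono[OF n(3) ab] by (simp add: mult.commute)
  also have "\<dots> \<le> ((k+1)^2 * (l+1)^2) * (n+1)^2"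
    using k l pos by (intro mult_right_mono mult_mono) auto
  finally have "(a * b)^2 < ((k+1) * (l+1) * (n+1))^2"
    by (simp add: power2_eq_square ac_simps)
  then have big: "a * b < (k+1) * (l+1) * (n+1)"
    by (rule power_less_imp_less_base) (use k l n in auto)
  have "int (card (f ` B)) \<le> int (card ({0..<b} \<times> {0..<a}))"
    unfolding of_nat_le_iff using pos by (intro card_mono) (auto simp: f_def)
  also have "\<dots> = a * b" using pos by simp
  also have "\<dots> < int (card B)"
    using big k l n by (simp add: B_def card_cartesian_product mult.assoc)
  finally have "\<not> inj_on f B" by (intro pigeonhole) simp
  then obtain p p' where p: "p \<in> B" "p' \<in> B" "p \<noteq> p'" "f p = f p'" unfolding inj_on_def by blast
  obtain x1 y1 z1 where p1: "p = (x1, y1, z1)" by (cases p)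
  obtain x2 y2 z2 where p2: "p' = (x2, y2, z2)" by (cases p')
  define x y z where "x = x1 - x2" and "y = y1 - y2" and "z = z1 - z2"
  have ne: "(x, y, z) \<noteq> (0, 0, 0)" using p p1 p2 by (auto simp: x_def y_def z_def)
  have "\<bar>x\<bar> \<le> k" "\<bar>y\<bar> \<le> l" "\<bar>z\<bar> \<le> n"
    using p p1 p2 by (auto simp: x_def y_def z_def B_def)
  then have "x^2 \<le> k^2" "y^2 \<le> l^2" "z^2 \<le> n^2"
    using k l n by (auto simp: abs_le_square_iff[symmetric])
  then have xyz: "x^2 \<le> b" "y^2 \<le> a" "z^2 \<le> a * b" using k l n by linarith+
  define v where "v = a * x^2 + b * y^2 - z^2"
  have "[z1 - c * x1 = z2 - c * x2] (mod b)" "[z1 - d * y1 = z2 - d * y2] (mod a)"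
    using p p1 p2 by (auto simp: f_def cong_def)
  then have dv: "b dvd z - c * x" "a dvd z - d * y"
    by (auto simp: cong_iff_dvd_diff x_def y_def z_def algebra_simps)
  have cd: "b dvd a - c^2" "a dvd b - d^2"
    using c d by (auto simp: cong_iff_dvd_diff dvd_diff_commute)
  have "v = (a - c^2) * x^2 + b * y^2 - (z - c * x) * (z + c * x)"
    by (simp add: v_def power2_eq_square algebra_simps)
  then have "b dvd v" using dv cd by simp
  have "v = (b - d^2) * y^2 + a * x^2 - (z - d * y) * (z + d * y)"
    by (simp add: v_def power2_eq_square algebra_simps)
  then have "a dvd v" using dv cd by simp
  then have "a * b dvd v" using \<open>b dvd v\<close> cop by (simp add: divides_mult)
  then obtain e where e: "v = a * b * e" by blast
  have ax: "a * x^2 \<le> a * b" "b * y^2 \<le> a * b" "a * x^2 \<ge> 0" "b * y^2 \<ge> 0"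
    using xyz pos by (auto simp: mult.commute)
  \<comment> \<open>The sizes give -ab \<le> v \<le> 2ab, and either endpoint would make
    \<open>a * b\<close> a square, which \<open>nsq\<close> excludes.\<close>
  have "v \<noteq> 2 * (a * b)"
  proof
    assume "v = 2 * (a * b)"
    then have "a * x^2 = a * b" "b * y^2 = a * b" using ax zero_le_power2[of z] unfolding v_def by linarith+
    then have "x^2 = b" "y^2 = a" using pos by auto
    then have "(x * y)^2 = a * b" by (simp add: power_mult_distrib mult.commute)
    then show False using nsq by blast
  qed
  then have "v < 2 * (a * b)" using ax zero_le_power2[of z] unfolding v_def by linarith
  then have "(a * b) * e < (a * b) * 2" using e by simp
  then have "e < 2" using ab by (simp only: mult_less_cancel_left_pos)
  have "v > - (a * b)"
    using ax xyz nsq[of z] unfolding v_def by linarith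
  then have "(a * b) * (-1) < (a * b) * e" using e by simp
  then have "-1 < e" using ab by (simp only: mult_less_cancel_left_pos)
  then consider "e = 0" | "e = 1" using \<open>e < 2\<close> by linarith
  then show thesis
  proof cases
    case 1
    then have eq: "a * x^2 + b * y^2 = z^2" using e by (simp add: v_def)
    moreover have "(x, y) \<noteq> (0, 0)" using eq ne by auto
    ultimately show thesis by (rule that)
  next
    case 2
    \<comment> \<open>The value $ab$ also yields a zero: multiply $z^2 + ab = ax^2 + by^2$ by $z^2 + ab$ and use
      that the form $au^2 + bv^2$ represents the product as below.\<close>
    have zz: "z^2 = a * x^2 + b * y^2 - a * b" using 2 e by (simp add: v_def)
    have eq: "a * (x * z + b * y)^2 + b * (y * z - a * x)^2 = (z^2 + a * b)^2"
    proof -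
      have "a * (x * z + b * y)^2 + b * (y * z - a * x)^2 = (z^2 + a * b) * (a * x^2 + b * y^2)"
        by (simp add: power2_eq_square algebra_simps)
      also have "a * x^2 + b * y^2 = z^2 + a * b" using zz by simp
      finally show ?thesis by (simp add: power2_eq_square)
    qed
    have "z^2 + a * b > 0" using ab zero_le_power2[of z] by linarith
    then have "(x * z + b * y, y * z - a * x) \<noteq> (0, 0)" using eq by auto
    with eq show thesis by (rule that)
  qed
qed

section \<open>Primitive solutions of \<open>37 * x^2 - q * y^2 = z^2\<close>\<close>

lemma primitive_solution:
  fixes a b :: int
  assumes "a * x^2 + b * y^2 = z^2" "(x, y) \<noteq> (0, 0)"
  obtains x' y' z' where "a * x'^2 + b * y'^2 = z'^2" "coprime x' y'"
proof -
  define g where "g = gcd x y"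
  have g0: "g \<noteq> 0" using assms by (auto simp: g_def)
  obtain x' y' where xy: "x = x' * g" "y = y' * g" "coprime x' y'"
    using gcd_coprime_exists[of x y] g0 unfolding g_def by blast
  have "z^2 = g^2 * (a * x'^2 + b * y'^2)"
    using assms xy by (simp add: power_mult_distrib algebra_simps)
  then have "g^2 dvd z^2" by simp
  then have "g dvd z" by simp
  then obtain z' where z: "z = g * z'" by blast
  have "g^2 * (a * x'^2 + b * y'^2) = g^2 * z'^2"
    using \<open>z^2 = _\<close> unfolding z power_mult_distrib by (rule sym)
  then have "a * x'^2 + b * y'^2 = z'^2" using g0 mult_left_cancel[of "g^2"] by fastforce
  then show thesis using xy that by blast
qed

text \<open>A prime dividing \<open>x\<close> and \<open>b\<close> divides \<open>z\<close>, so its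
  square divides \<open>b * y^2\<close>; being prime to \<open>y\<close>, it would divide
  \<open>b\<close> twice.\<close>

lemma coprime_of_primitive_solution:
  fixes a b :: int
  assumes eq: "a * x^2 + b * y^2 = z^2" and cop: "coprime x y" and sf: "squarefree b"
  shows "coprime x b"
proof (rule ccontr)
  assume "\<not> coprime x b"
  then obtain p where p: "prime p" "p dvd x" "p dvd b"
    using prime_factor_int[of "gcd x b"] by (auto simp: coprime_iff_gcd_eq_1)
  have "p dvd a * x^2 + b * y^2" using p by (simp add: power2_eq_square)
  then have "p dvd z" using eq p by (auto simp: prime_dvd_power_iff)
  then have "p^2 dvd z^2" "p^2 dvd x^2" using p by auto
  then have "p^2 dvd z^2 - a * x^2" by simp
  then have "p^2 dvd b * y^2" unfolding eq[symmetric] by simp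
  moreover have "coprime (p^2) (y^2)"
    using coprime_divisors[OF p(2) dvd_refl cop] by simp
  ultimately have "p^2 dvd b" by (simp add: coprime_dvd_mult_left_iff)
  then have "is_unit p" using sf by (auto simp: squarefree_def)
  then show False using p by auto
qed

text \<open>Legendre's theorem is applied to 37 and \<open>N = - q\<close>. Each prime in
  \<open>S\<close> is a square modulo 37, and since 37 is 1 modulo 4, reciprocity makes 37 a square
  modulo each of them.\<close>

lemma ternary_37:
  fixes S :: "int set" and q :: int
  assumes S: "finite S" "\<forall>p\<in>S. prime p" "\<forall>p\<in>S. Legendre p 37 = 1"
    and q: "q = - (\<Prod>p\<in>S. p)" "[q = 1] (mod 8)"
  obtains x y z where "37 * x^2 - q * y^2 = z^2" "coprime x (q * y)" "coprime 37 y"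
    "coprime 37 q" "q < 0" "squarefree q"
proof -
  define N where "N = (\<Prod>p\<in>S. p)"
  have p37: "prime (37::int)" by (simp add: prime_int_numeral_eq)
  have sq: "QuadRes 37 p" "\<not> 37 dvd p" if "p \<in> S" for p
    using that S(3) by (auto simp: Legendre_def cong_0_iff split: if_splits)
  have ndvd: "\<not> 37 dvd N"
    unfolding N_def using S sq p37 by (auto simp: prime_dvd_prod_iff)
  have cop: "coprime 37 N" using ndvd p37 by (simp add: prime_imp_coprime)
  have "q mod 8 = 1" using q by (simp add: cong_def)
  then have odd: "odd N" using q unfolding N_def by presburger
  have qr: "QuadRes p 37" if "p \<in> S" for p
  proof -
    \<comment> \<open>Reciprocity is for odd primes; the congruence of \<open>q\<close> modulo 8
      keeps 2 out of \<open>S\<close>.\<close>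
    have "p \<noteq> 2" using odd that S unfolding N_def by (auto simp: even_prod_iff)
    then have "2 < p" using S that prime_ge_2_int[of p] by force
    have "p \<noteq> 37" using sq(2)[OF that] by auto
    have primes: "prime (nat p)" "prime (nat 37)"
      using S(2) that p37 by (metis prime_int_nat_transfer)+
    have "Legendre p 37 * Legendre 37 p = (-1::int) ^ (nat ((p - 1) div 2 * ((37 - 1) div 2)))"
      using primes \<open>2 < p\<close> \<open>p \<noteq> 37\<close> by (intro Quadratic_Reciprocity_int) simp_all
    \<comment> \<open>Half of 37 - 1 is 18, so the sign in the reciprocity law is +1.\<close>
    moreover have "nat ((p - 1) div 2 * ((37 - 1) div 2)) = 2 * (nat ((p - 1) div 2) * 9)"
      using \<open>2 < p\<close> by (simp add: nat_mult_distrib)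
    ultimately have "Legendre 37 p = 1" using S(3) that by (simp only: power_mult) simp
    then show ?thesis by (auto simp: Legendre_def split: if_splits)
  qed
  have "N > 0" unfolding N_def using S by (intro prod_pos) (auto simp: prime_gt_0_int)
  have "QuadRes N 37" unfolding N_def using S qr by (intro QuadRes_prod_modulus) auto
  moreover have "QuadRes 37 N" unfolding N_def using S sq by (intro QuadRes_prod) auto
  moreover have "k^2 \<noteq> 37 * N" for k
  proof
    assume k: "k^2 = 37 * N"
    then have "37 dvd k^2" by simp
    then have "37 dvd k" using p37 by (auto simp: prime_dvd_power_iff)
    then have "37^2 dvd k^2" by (simp only: dvd_power_same)
    then show False using k ndvd by (auto simp: power2_eq_square)
  qed
  ultimately obtain x y z where 1: "37 * x^2 + N * y^2 = z^2" "(x, y) \<noteq> (0, 0)"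
    using Legendre_ternary[of 37 N] \<open>N > 0\<close> cop zero_less_numeral by blast
  then obtain x y z where 2: "37 * x^2 + N * y^2 = z^2" "coprime x y"
    using primitive_solution by blast
  have "coprime x N"
    using coprime_of_primitive_solution[OF 2] S squarefree_prod_primes_int unfolding N_def by blast
  \<comment> \<open>The same lemma with the two coefficients exchanged, 37 being squarefree.\<close>
  moreover have "coprime y 37"
    using 2 p37 by (intro coprime_of_primitive_solution[of N y 37 x z])
      (auto simp: add.commute coprime_commute squarefree_prime)
  ultimately show thesis
    using that[of x y z] 2 q cop \<open>N > 0\<close> squarefree_prod_primes_int S unfolding N_def
    by (simp add: coprime_commute)
qed

text \<open>If \<open>x\<close> were even, \<open>y\<close> would be odd and \<open>z^2\<close>
  would be 3 modulo 4. If \<open>x\<close> and \<open>y\<close> are both odd, the left side is 37 -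
  1 = 36, hence 4, modulo 8, so 2 divides \<open>z\<close> exactly once.\<close>

lemma solution_parity:
  fixes q x y z :: int
  assumes eq: "37 * x^2 - q * y^2 = z^2" and q: "[q = 1] (mod 8)" and cop: "coprime x (q * y)"
  shows "odd x \<and> (even y \<and> odd z \<or> odd y \<and> (\<exists>w. odd w \<and> z = 2 * w))"
proof -
  obtain t where t: "q = 8 * t + 1" using q by (rule cong_int_obtain)
  have "odd x"
  proof
    assume "even x"
    then obtain a where a: "x = 2 * a" by blast
    then have "odd y" using cop by (auto simp: coprime_mult_right_iff)
    then obtain b where b: "y = 2 * b + 1" by (elim oddE)
    have "z^2 mod 4 = (37 * x^2 - q * y^2) mod 4" using eq by simp
    also have "37 * x^2 - q * y^2 = 4 * (37 * a^2 - 8 * t * b^2 - 8 * t * b - 2 * t - b^2 - b - 1) + 3"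
      unfolding a b t by (simp add: power2_eq_square algebra_simps)
    also have "\<dots> mod 4 = 3" by presburger
    finally have "z^2 mod 4 = 3" .
    moreover have "z^2 mod 4 = (z mod 4)^2 mod 4" by (simp add: power_mod)
    moreover have "z mod 4 = 0 \<or> z mod 4 = 1 \<or> z mod 4 = 2 \<or> z mod 4 = 3" by presburger
    ultimately show False by auto
  qed
  show ?thesis
  proof (cases "even y")
    case True
    have "odd (37 * x^2 - q * y^2)" using True \<open>odd x\<close> by simp
    then show ?thesis using True \<open>odd x\<close> eq by simp
  next
    case False
    then obtain b where b: "y = 2 * b + 1" by (elim oddE)
    obtain a where a: "x = 2 * a + 1" using \<open>odd x\<close> by (elim oddE)
    have "even (z^2)" unfolding eq[symmetric] using \<open>odd x\<close> False t by simp
    then obtain w where w: "z = 2 * w" by auto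
    \<comment> \<open>This is the reason why odd squares are 1 modulo 8.\<close>
    have ev: "even (a * (a + 1))" "even (b * (b + 1))" by auto
    have "4 * w^2 = 37 * x^2 - q * y^2" using w eq by (simp add: power_mult_distrib)
    also have "\<dots> = 4 * (37 * (a * (a + 1)) - (8 * t + 1) * (b * (b + 1)) + 9 - 2 * t)"
      unfolding a b t by (simp add: power2_eq_square algebra_simps)
    finally have "w^2 = 37 * (a * (a + 1)) - (8 * t + 1) * (b * (b + 1)) + 9 - 2 * t" by simp
    then have "odd (w^2)" using ev by simp
    then have "odd w" by simp
    then show ?thesis using False \<open>odd x\<close> w by blast
  qed
qed

section \<open>Integers of an imaginary quadratic field\<close>

lemma poly_map_of_int_hom:
  fixes x :: "'a :: comm_ring_1"
  shows "poly (map_poly of_int (p + q)) x = poly (map_poly of_int p) x + poly (map_poly of_int q) x"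
    and "poly (map_poly of_int (p * q)) x = poly (map_poly of_int p) x * poly (map_poly of_int q) x"
    and "poly (map_poly of_int (Polynomial.smult a p)) x = of_int a * poly (map_poly of_int p) x"
proof -
  have "map_poly of_int (p + q) = map_poly of_int p + (map_poly of_int q :: 'a poly)"
    by (rule poly_eqI) (simp add: coeff_map_poly)
  then show "poly (map_poly of_int (p + q)) x = poly (map_poly of_int p) x + poly (map_poly of_int q) x"
    by simp
  have "map_poly of_int (p * q) = map_poly of_int p * (map_poly of_int q :: 'a poly)"
    by (rule poly_eqI) (simp add: coeff_map_poly coeff_mult)
  then show "poly (map_poly of_int (p * q)) x = poly (map_poly of_int p) x * poly (map_poly of_int q) x"
    by simp
  have "map_poly of_int (Polynomial.smult a p) = Polynomial.smult (of_int a) (map_poly of_int p :: 'a poly)"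
    by (rule poly_eqI) (simp add: coeff_map_poly)
  then show "poly (map_poly of_int (Polynomial.smult a p)) x = of_int a * poly (map_poly of_int p) x"
    by simp
qed

text \<open>Gauss's lemma: the primitive quadratic polynomial vanishing at $x$ divides a monic integer
  polynomial, so its leading coefficient is a unit.\<close>
lemma algebraic_int_quadratic:
  fixes x :: complex
  assumes "algebraic_int x" "x \<notin> \<rat>" "a \<noteq> 0"
    and root: "of_int a * x^2 + of_int b * x + of_int c = 0"
  obtains s n :: int where "x^2 = of_int s * x + of_int n"
proof -
  define ev where "ev p = poly (map_poly of_int p) x" for p
  note ev_hom = poly_map_of_int_hom[of _ _ x, folded ev_def] poly_map_of_int_hom(3)[of _ _ x, folded ev_def]
  have ev_pCons: "ev (pCons a p) = of_int a + x * ev p" for a p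
    by (simp add: ev_def map_poly_pCons)
  have ev_0: "ev 0 = 0" by (simp add: ev_def)
  obtain p :: "int poly" where p: "ev p = 0" "lead_coeff p = 1"
    using assms(1) by (auto simp: algebraic_int_altdef_ipoly ev_def)
  define F where "F = primitive_part [:c, b, a:]"
  have deg: "degree F = 2" using \<open>a \<noteq> 0\<close> by (simp add: F_def)
  then have "F \<noteq> 0" by auto
  have "ev (Polynomial.smult (content [:c, b, a:]) F) = 0"
    using root unfolding F_def content_times_primitive_part
    by (simp add: ev_pCons ev_0 power2_eq_square algebra_simps)
  then have F0: "ev F = 0"
    using \<open>a \<noteq> 0\<close> by (simp add: ev_hom)
  \<comment> \<open>Pseudo-division stays within integer polynomials. The remainder has degree at
    most 1 and vanishes at the irrational number \<open>x\<close>, so it is 0.\<close>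
  define r where "r = pseudo_mod p F"
  obtain d h where dh: "d \<noteq> 0" "Polynomial.smult d p = F * h + r"
    using pseudo_mod(1)[OF \<open>F \<noteq> 0\<close>, of p] unfolding r_def by blast
  have "degree r \<le> 1"
    using pseudo_mod(2)[OF \<open>F \<noteq> 0\<close>, of p] deg unfolding r_def by auto
  then have "r = [:poly.coeff r 0, poly.coeff r 1:]"
    by (intro poly_eqI) (auto simp: coeff_pCons coeff_eq_0 split: nat.splits)
  then obtain r0 r1 where r: "r = [:r0, r1:]" by blast
  have "ev r = 0"
    using arg_cong[OF dh(2), of ev] by (simp add: ev_hom F0 p)
  then have r_root: "of_int r0 + x * of_int r1 = 0" by (simp add: r ev_pCons ev_0)
  have "r1 = 0"
  proof (rule ccontr)
    assume "r1 \<noteq> 0"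
    then have "x = - of_int r0 / of_int r1" using r_root by (simp add: field_simps add_eq_0_iff)
    then show False using assms(2) by simp
  qed
  then have "r = 0" using r r_root by simp
  \<comment> \<open>The monic \<open>p\<close> has content 1, so passing to primitive parts in
    \<open>d * p = F * h\<close> replaces \<open>d\<close> by its sign.\<close>
  have "is_unit (content p)" using content_dvd_coeff[of p "degree p"] unfolding p(2) .
  then have "content p = 1" by (simp only: is_unit_content_iff)
  then have "primitive_part p = p" using content_times_primitive_part[of p] by simp
  moreover have "primitive_part F = F"
    unfolding F_def using \<open>a \<noteq> 0\<close> by (intro primitive_part_prim content_primitive_part) simp
  ultimately have "Polynomial.smult (sgn d) p = F * primitive_part h"
    using arg_cong[OF dh(2), of primitive_part] \<open>r = 0\<close> \<open>F \<noteq> 0\<close>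
    by (simp add: primitive_part_smult primitive_part_mult)
  then have "lead_coeff F * lead_coeff (primitive_part h) = sgn d"
    using p by (metis lead_coeff_mult lead_coeff_smult mult.right_neutral)
  then have "lead_coeff F dvd sgn d" by (metis dvd_triv_left)
  then have "is_unit (lead_coeff F)" using \<open>d \<noteq> 0\<close> by (auto simp: sgn_if split: if_splits)
  then have lc: "\<bar>poly.coeff F 2\<bar> = 1" using deg by simp
  obtain u v w where F: "F = [:u, v, w:]" using deg by (rule degree2_coeffs)
  have coeff_w: "poly.coeff [:u, v, w:] 2 = w" by (simp add: coeff_pCons numeral_2_eq_2)
  have w: "w = 1 \<or> w = -1"
    using lc unfolding F coeff_w by linarith
  have "of_int u + x * (of_int v + x * of_int w) = 0" using F0 by (simp add: F ev_pCons ev_0)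
  then have wx: "of_int w * x^2 = - of_int v * x - of_int u"
    by (simp add: power2_eq_square algebra_simps add_eq_0_iff2)
  have "x^2 = of_int (w * w) * x^2" using w by auto
  also have "\<dots> = of_int w * (of_int w * x^2)" by simp
  also have "\<dots> = of_int (- w * v) * x + of_int (- w * u)"
    unfolding wx by (simp add: algebra_simps)
  finally have "x^2 = of_int (- w * v) * x + of_int (- w * u)" .
  then show thesis by (rule that)
qed

lemma rat_quotient:
  fixes r :: rat
  obtains u v :: int where "r = of_int u / of_int v" "v \<noteq> 0"
proof -
  obtain u v where uv: "quotient_of r = (u, v)" by (cases "quotient_of r")
  then show thesis using that[of u v] quotient_of_denom_pos[OF uv] quotient_of_div[OF uv] by simp
qed

text \<open>In lowest terms the square of the denominator must divide \<open>m\<close>.\<close>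

lemma squarefree_mult_square_rat_Ints:
  fixes r :: rat
  assumes "squarefree m" "of_int m * r^2 \<in> \<int>"
  shows "r \<in> \<int>"
proof -
  obtain u v where uv: "quotient_of r = (u, v)" by (cases "quotient_of r")
  then have v: "v > 0" "coprime u v" "r = of_int u / of_int v"
    using quotient_of_denom_pos quotient_of_coprime quotient_of_div by blast+
  obtain n where "of_int m * r^2 = of_int n" using assms(2) by (auto elim: Ints_cases)
  then have "of_int (m * u^2) = (of_int (n * v^2) :: rat)"
    using v by (simp add: power_divide field_simps)
  then have "m * u^2 = n * v^2" by (simp only: of_int_eq_iff)
  then have "v^2 dvd m * u^2" by simp
  moreover have "coprime (v^2) (u^2)" using v by (simp add: coprime_commute)
  ultimately have "v^2 dvd m" by (simp add: coprime_dvd_mult_left_iff)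
  then have "is_unit v" using assms(1) by (auto simp: squarefree_def)
  then have "v = 1" using v by simp
  then show ?thesis using v by simp
qed

section \<open>Arithmetic of the field generated by the square root of \<open>m\<close>, with
  \<open>m\<close> = 1 modulo 4\<close>

locale imag_quad_field =
  fixes m :: int
  assumes m: "squarefree m" "m < 0" "[m = 1] (mod 4)"
begin

definition rho ("\<rho>") where "\<rho> = csqrt (of_int m)"
definition omega ("\<omega>") where "\<omega> = (1 + \<rho>) / 2"
abbreviation "K \<equiv> quad_field m"
abbreviation "R \<equiv> ring_of_integers K"

lemma rho_sq: "\<rho>^2 = of_int m"
  by (simp add: rho_def)

lemma rho_mult: "\<rho> * \<rho> = of_int m" "\<rho> * (\<rho> * x) = of_int m * x"
  using rho_sq by (simp_all add: power2_eq_square flip: mult.assoc)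

lemma quad_field_eq: "K = {of_rat a + of_rat b * \<rho> | a b. True}"
  by (simp add: quad_field_def rho_def)

lemma omega_sq: "\<omega>^2 = \<omega> + of_int ((m - 1) div 4)"
proof -
  obtain k where k: "m = 4 * k + 1" using m(3) by (metis cong_iff_lin cong_sym add.commute)
  have "of_int m = (4 * of_int k + 1 :: complex)" "(m - 1) div 4 = k"
    using k by simp_all
  then show ?thesis by (simp add: omega_def power2_eq_square field_simps rho_mult)
qed

lemma quad_fieldI: "of_rat a + of_rat b * \<rho> \<in> K"
  by (auto simp: quad_field_eq)

lemma of_rat_in_K: "of_rat a \<in> K"
  using quad_fieldI[of a 0] by simp

lemma K_mult: "x \<in> K \<Longrightarrow> y \<in> K \<Longrightarrow> x * y \<in> K"
proof -
  assume "x \<in> K" "y \<in> K"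
  then obtain a b c d where "x = of_rat a + of_rat b * \<rho>" "y = of_rat c + of_rat d * \<rho>"
    by (auto simp: quad_field_eq)
  then have "x * y = of_rat a * of_rat c + of_rat b * of_rat d * \<rho>^2 + (of_rat a * of_rat d + of_rat b * of_rat c) * \<rho>"
    by (simp add: power2_eq_square algebra_simps)
  also have "\<dots> = of_rat (a * c + b * d * of_int m) + of_rat (a * d + b * c) * \<rho>"
    by (simp add: of_rat_add of_rat_mult rho_sq)
  finally show ?thesis using quad_fieldI by simp
qed

lemma K_inverse: "x \<in> K \<Longrightarrow> inverse x \<in> K"
proof -
  assume "x \<in> K"
  then obtain a b where x: "x = of_rat a + of_rat b * \<rho>"
    by (auto simp: quad_field_eq)
  \<comment> \<open>The norm of \<open>x\<close>; as \<open>m\<close> is negative, it is a sum of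
    two nonnegative terms and vanishes only at 0.\<close>
  define n where "n = a^2 - of_int m * b^2"
  have n: "x * (of_rat a - of_rat b * \<rho>) = of_rat n"
    unfolding x n_def of_rat_diff of_rat_mult of_rat_power
    by (simp add: power2_eq_square algebra_simps rho_mult)
  have "n = 0 \<longrightarrow> a = 0 \<and> b = 0"
  proof
    assume "n = 0"
    have "of_int m * b^2 \<le> 0" using m(2) by (simp add: mult_nonpos_nonneg)
    then have "a^2 = 0" "of_int m * b^2 = 0" using \<open>n = 0\<close> zero_le_power2[of a] unfolding n_def by linarith+
    then show "a = 0 \<and> b = 0" using m(2) by simp
  qed
  moreover have ?thesis if "n \<noteq> 0"
  proof -
    have "x * ((of_rat a - of_rat b * \<rho>) * of_rat (inverse n)) = of_rat n * of_rat (inverse n)"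
      unfolding n[symmetric] by simp
    also have "\<dots> = 1" using that by (simp flip: of_rat_mult)
    finally have "inverse x = (of_rat a - of_rat b * \<rho>) * of_rat (inverse n)"
      by (rule inverse_unique)
    also have "\<dots> = of_rat (a * inverse n) + of_rat (- b * inverse n) * \<rho>"
      by (simp add: of_rat_mult of_rat_minus algebra_simps)
    finally show ?thesis using quad_fieldI by simp
  qed
  ultimately show ?thesis using x of_rat_in_K[of 0] by fastforce
qed

text \<open>Squaring a relation between 1 and \<rho> equates a nonnegative rational with a
  nonpositive one, since \<open>m < 0\<close>.\<close>

lemma rational_part_unique:
  assumes "of_rat a + of_rat b * \<rho> = of_rat c + of_rat d * \<rho>"
  shows "a = c" "b = d"
proof -
  have eq: "of_rat (a - c) = of_rat (d - b) * \<rho>"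
    using assms by (simp add: of_rat_diff algebra_simps)
  then have "of_rat ((a - c)^2) = (of_rat ((d - b)^2 * of_int m) :: complex)"
    by (simp add: of_rat_power of_rat_mult power_mult_distrib rho_sq)
  then have sq: "(a - c)^2 = (d - b)^2 * of_int m" by (simp only: of_rat_eq_iff)
  moreover have "(d - b)^2 * of_int m \<le> 0" using m(2) by (simp add: mult_nonneg_nonpos)
  ultimately have "(a - c)^2 = 0" using zero_le_power2[of "a - c"] by linarith
  then show "a = c" "b = d" using sq m(2) by auto
qed

text \<open>An irrational integer a + b\<rho> satisfies a monic integral quadratic equation.
  Comparison with its trace and norm shows that \<open>2 * a\<close> and
  \<open>m * (2 * b)^2\<close> are integers; \<open>m\<close> being squarefree, \<open>2 * b\<close>
  is an integer, and as \<open>m\<close> is odd, it has the parity of \<open>2 * a\<close>.\<close>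

theorem ring_of_integers_quad_field:
  "R = {of_int i + of_int j * \<omega> | i j. True}"
proof (intro equalityI subsetI)
  fix x assume "x \<in> R"
  then have "x \<in> K" and alg: "algebraic_int x" by (auto simp: ring_of_integers_def)
  then obtain a b where x: "x = of_rat a + of_rat b * \<rho>" by (auto simp: quad_field_eq)
  show "x \<in> {of_int i + of_int j * \<omega> | i j. True}"
  proof (cases "b = 0")
    case True
    then have "x \<in> \<rat>" using x by simp
    then have "x \<in> \<int>" using alg by (rule rational_algebraic_int_is_int[rotated])
    then obtain i where "x = of_int i" by (rule Ints_cases)
    then have "x = of_int i + of_int 0 * \<omega>" by simp
    then show ?thesis by blast
  next
    case False
    have irrat: "x \<notin> \<rat>"
    proof
      assume "x \<in> \<rat>"
      then obtain c where "x = of_rat c" by (rule Rats_cases)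
      then have "x = of_rat c + of_rat 0 * \<rho>" by simp
      then show False using False x rational_part_unique(2) by metis
    qed
    have min: "x^2 = of_rat (2 * a) * x - of_rat (a^2 - of_int m * b^2)"
      unfolding x
      by (simp add: rho_mult of_rat_diff of_rat_mult of_rat_power power2_eq_square algebra_simps)
    obtain t1 t2 where t: "2 * a = of_int t1 / of_int t2" "t2 \<noteq> 0"
      by (rule rat_quotient)
    obtain n1 n2 where n: "a^2 - of_int m * b^2 = of_int n1 / of_int n2" "n2 \<noteq> 0"
      by (rule rat_quotient)
    have "of_int (t2 * n2) * x^2 + of_int (- t1 * n2) * x + of_int (n1 * t2) = 0"
      unfolding min t n using t(2) n(2) by (simp add: of_rat_divide field_simps)
    moreover have "t2 * n2 \<noteq> 0" using t n by simp
    ultimately obtain s n where sn: "x^2 = of_int s * x + of_int n"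
      using algebraic_int_quadratic[OF alg irrat] by metis
    have "of_rat (2 * a^2 - (a^2 - of_int m * b^2)) + of_rat (2 * a * b) * \<rho> = x^2"
      unfolding min unfolding x by (simp add: rho_mult of_rat_diff of_rat_mult of_rat_add power2_eq_square algebra_simps)
    also have "\<dots> = of_rat (of_int s * a + of_int n) + of_rat (of_int s * b) * \<rho>"
      unfolding sn unfolding x by (simp add: of_rat_mult of_rat_add algebra_simps)
    finally have 1: "2 * a^2 - (a^2 - of_int m * b^2) = of_int s * a + of_int n" "2 * a * b = of_int s * b"
      using rational_part_unique by blast+
    then have s: "of_int s = 2 * a" using False by simp
    then have s4: "of_int m * (2 * b)^2 = of_int (s^2 + 4 * n)"
      using 1(1) by (simp add: power2_eq_square algebra_simps)
    then have "of_int m * (2 * b)^2 \<in> \<int>" by (simp only: Ints_of_int)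
    then have "2 * b \<in> \<int>" by (rule squarefree_mult_square_rat_Ints[OF m(1)])
    then obtain j where j: "2 * b = of_int j" by (rule Ints_cases)
    have "of_int (m * j^2) = (of_int (s^2 + 4 * n) :: rat)" using s4 j by simp
    then have mj: "m * j^2 = s^2 + 4 * n" by (simp only: of_int_eq_iff)
    have "odd m" using m(3) by (simp add: cong_def) presburger
    have "even (m * j^2) \<longleftrightarrow> even (s^2 + 4 * n)" using mj by simp
    then have "even (s - j)" using \<open>odd m\<close> by simp
    then obtain i where i: "s - j = 2 * i" by blast
    have "of_int (s - j) = (of_int (2 * i) :: rat)" using i by simp
    then have a: "a = b + of_int i" using s j by simp
    have a': "of_rat a = of_rat b + (of_int i :: complex)"
      by (metis a of_rat_add of_rat_of_int_eq)
    have j': "of_int j = (2 * of_rat b :: complex)"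
      by (metis j of_rat_mult of_rat_numeral_eq of_rat_of_int_eq)
    have "x = of_int i + of_int j * \<omega>"
      unfolding x omega_def a' j' by (simp add: field_simps)
    then show ?thesis by auto
  qed
next
  fix x assume "x \<in> {of_int i + of_int j * \<omega> | i j. True}"
  then obtain i j where x: "x = of_int i + of_int j * \<omega>" by auto
  have "x = of_rat (of_int i + of_int j / 2) + of_rat (of_int j / 2) * \<rho>"
    unfolding x omega_def of_rat_add of_rat_divide by (simp add: field_simps)
  then have "x \<in> K" using quad_fieldI by simp
  \<comment> \<open>The characteristic polynomial of i + j\<omega>, with its norm as constant term
    and trace \<open>2 * i + j\<close>.\<close>
  define p :: "complex poly" where "p = [:of_int (i^2 + i * j - j^2 * ((m - 1) div 4)), of_int (- (2 * i + j)), 1:]"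
  have "poly p x = of_int j ^ 2 * (\<omega>^2 - \<omega> - of_int ((m - 1) div 4))"
    unfolding x p_def by (simp add: power2_eq_square algebra_simps)
  then have "poly p x = 0" using omega_sq by simp
  moreover have "\<forall>k. poly.coeff p k \<in> \<int>"
    unfolding p_def by (auto simp: coeff_pCons split: nat.splits)
  moreover have "lead_coeff p = 1" by (simp add: p_def)
  ultimately have "algebraic_int x" by (intro algebraic_int.intros) auto
  then show "x \<in> R" using \<open>x \<in> K\<close> by (simp add: ring_of_integers_def)
qed


lemma R_iff: "x \<in> R \<longleftrightarrow> (\<exists>i j. x = of_int i + of_int j * \<omega>)"
  using ring_of_integers_quad_field by auto

lemma R_of_int [intro]: "of_int i \<in> R"
  unfolding R_iff by (rule exI[of _ i], rule exI[of _ 0]) simp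

lemma R_simps [simp, intro]: "0 \<in> R" "1 \<in> R" "numeral n \<in> R"
  using R_of_int[of 0] R_of_int[of 1] R_of_int[of "numeral n"] by simp_all

lemma R_omega [intro]: "\<omega> \<in> R"
  unfolding R_iff by (rule exI[of _ 0], rule exI[of _ 1]) simp

lemma R_rho [intro]: "\<rho> \<in> R"
  unfolding R_iff by (rule exI[of _ "-1"], rule exI[of _ 2]) (simp add: omega_def field_simps)

lemma R_add [intro]: "x \<in> R \<Longrightarrow> y \<in> R \<Longrightarrow> x + y \<in> R"
proof -
  assume "x \<in> R" "y \<in> R"
  then obtain i j k l where "x = of_int i + of_int j * \<omega>" "y = of_int k + of_int l * \<omega>"
    unfolding R_iff by blast
  then have "x + y = of_int (i + k) + of_int (j + l) * \<omega>" by (simp add: algebra_simps)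
  then show ?thesis unfolding R_iff by blast
qed

lemma R_mult [intro]: "x \<in> R \<Longrightarrow> y \<in> R \<Longrightarrow> x * y \<in> R"
proof -
  assume "x \<in> R" "y \<in> R"
  then obtain i j k l where "x = of_int i + of_int j * \<omega>" "y = of_int k + of_int l * \<omega>"
    unfolding R_iff by blast
  then have "x * y = of_int (i * k) + of_int (i * l + j * k) * \<omega> + of_int (j * l) * \<omega>^2"
    by (simp add: power2_eq_square algebra_simps)
  also have "\<dots> = of_int (i * k + j * l * ((m - 1) div 4)) + of_int (i * l + j * k + j * l) * \<omega>"
    unfolding omega_sq by (simp add: algebra_simps)
  finally show ?thesis unfolding R_iff by blast
qed

lemma R_uminus [intro]: "x \<in> R \<Longrightarrow> - x \<in> R"
  using R_mult[OF R_of_int[of "-1"], of x] by simp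

lemma R_diff [intro]: "x \<in> R \<Longrightarrow> y \<in> R \<Longrightarrow> x - y \<in> R"
  using R_add[OF _ R_uminus, of x y] by simp

lemma R_power [intro]: "x \<in> R \<Longrightarrow> x ^ n \<in> R"
  by (induction n) auto

lemma R_subset_K: "x \<in> R \<Longrightarrow> x \<in> K"
  by (simp add: ring_of_integers_def)

lemma K_uminus: "x \<in> K \<Longrightarrow> - x \<in> K"
  using K_mult[OF R_subset_K[OF R_of_int[of "-1"]], of x] by simp

lemma K_divide: "x \<in> K \<Longrightarrow> y \<in> K \<Longrightarrow> x / y \<in> K"
  unfolding divide_inverse by (intro K_mult K_inverse)

lemma K_power: "x \<in> K \<Longrightarrow> x ^ n \<in> K"
  by (induction n) (auto intro: R_subset_K K_mult)

end

section \<open>Localisation at a prime ideal\<close>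

locale imag_quad_prime = imag_quad_field +
  fixes P :: "complex set"
  assumes prime: "prime_of K P"
begin

abbreviation "L \<equiv> local_ring K P"
abbreviation "U \<equiv> local_unit K P"

lemma P_0: "0 \<in> P"
  and P_1: "1 \<notin> P"
  and P_add: "x \<in> P \<Longrightarrow> y \<in> P \<Longrightarrow> x + y \<in> P"
  and P_mult: "a \<in> R \<Longrightarrow> x \<in> P \<Longrightarrow> a * x \<in> P"
  and P_prime: "x \<in> R \<Longrightarrow> y \<in> R \<Longrightarrow> x * y \<in> P \<Longrightarrow> x \<in> P \<or> y \<in> P"
  using prime unfolding prime_of_def Let_def by blast+

lemma P_diff: "x \<in> P \<Longrightarrow> y \<in> P \<Longrightarrow> x - y \<in> P"
  using P_add[OF _ P_mult[OF R_of_int[of "-1"]], of x y] by simp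

lemma P_coprime:
  assumes "coprime a b" "of_int a \<in> P"
  shows "of_int b \<notin> P"
proof
  assume b: "of_int b \<in> P"
  obtain u v where "u * a + v * b = 1" using bezout_int[of a b] assms(1) by auto
  then have "of_int u * of_int a + of_int v * of_int b = (1 :: complex)"
    by (metis of_int_1 of_int_add of_int_mult)
  moreover have "of_int u * of_int a + of_int v * of_int b \<in> P"
    using assms b by (intro P_add P_mult R_of_int)
  ultimately show False using P_1 by simp
qed

lemma R_subset_L: "x \<in> R \<Longrightarrow> x \<in> L"
  unfolding local_ring_def using P_1 R_subset_K by (auto intro!: bexI[of _ 1])

lemma L_mult: "x \<in> L \<Longrightarrow> y \<in> L \<Longrightarrow> x * y \<in> L"
proof -
  assume "x \<in> L" "y \<in> L"
  then obtain d e where de: "d \<in> R - P" "d * x \<in> R" "e \<in> R - P" "e * y \<in> R" "x \<in> K" "y \<in> K"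
    unfolding local_ring_def by blast
  have "(d * e) * (x * y) = (d * x) * (e * y)" by simp
  then have "(d * e) * (x * y) \<in> R" using de R_mult by metis
  moreover have "d * e \<in> R - P" using de P_prime by blast
  ultimately show ?thesis unfolding local_ring_def using de K_mult by blast
qed

lemma L_simps [simp, intro]: "0 \<in> L" "1 \<in> L" "numeral n \<in> L"
  by (simp_all add: R_subset_L)

lemma L_uminus: "x \<in> L \<Longrightarrow> - x \<in> L"
  using L_mult[OF R_subset_L[OF R_of_int[of "-1"]], of x] by simp

lemma L_power: "x \<in> L \<Longrightarrow> x ^ n \<in> L"
  by (induction n) (auto intro: L_mult)

lemma U_imp_L: "U x \<Longrightarrow> x \<in> L"
  by (simp add: local_unit_def)

lemma U_mult: "U x \<Longrightarrow> U y \<Longrightarrow> U (x * y)"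
  by (simp add: local_unit_def L_mult)

lemma U_inverse: "U x \<Longrightarrow> U (inverse x)"
  by (simp add: local_unit_def)

lemma U_divide: "U x \<Longrightarrow> U y \<Longrightarrow> U (x / y)"
  unfolding divide_inverse by (intro U_mult U_inverse)

lemma U_power: "U x \<Longrightarrow> U (x ^ n)"
proof (induction n)
  case 0
  then show ?case by (simp add: local_unit_def)
next
  case (Suc n)
  then show ?case by (simp add: U_mult)
qed

lemma L_divide: "x \<in> L \<Longrightarrow> U y \<Longrightarrow> x / y \<in> L"
  unfolding divide_inverse by (intro L_mult U_imp_L[of "inverse y"] U_inverse)

lemma U_of_R: "x \<in> R \<Longrightarrow> x \<notin> P \<Longrightarrow> U x"
proof -
  assume x: "x \<in> R" "x \<notin> P"
  then have "x \<noteq> 0" using P_0 by auto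
  moreover from this have "inverse x \<in> L"
    unfolding local_ring_def using x K_inverse R_subset_K by (auto intro!: bexI[of _ x])
  ultimately show ?thesis using x R_subset_L by (simp add: local_unit_def)
qed

lemma good_reductionI:
  assumes "u \<in> K" "u \<noteq> 0" "r \<in> K" "s \<in> K" "t \<in> K"
    and "change_coords u r s t E = (b1, b2, b3, b4, b6)"
    and "b1 \<in> L" "b2 \<in> L" "b3 \<in> L" "b4 \<in> L" "b6 \<in> L"
    and "U (disc (b1, b2, b3, b4, b6))"
  shows "good_reduction_at K P E"
  unfolding good_reduction_at_def using assms by (intro exI[of _ u] exI[of _ r] exI[of _ s] exI[of _ t]) simp

end

section \<open>Local models of the twists\<close>

text \<open>For D = 1, shifting y by 1/2 gives the integral model y^2 + y = x^3 + x^2 - 12 x - 17 of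
  discriminant 37^3; the family consists of its quadratic twists.\<close>

definition twist_curve :: "complex \<Rightarrow> weier" where
  "twist_curve D = (0, D, 0, - 12 * D^2, - 67 / 4 * D^3)"

lemma disc_twist_curve: "disc (twist_curve D) = 37^3 * D^6"
  by (simp add: twist_curve_def eval_nat_numeral)

lemma c4_twist_curve: "c4 (twist_curve D) = 592 * D^2"
  by (simp add: twist_curve_def power_mult_distrib)

lemma j_inv_twist_curve: "D \<noteq> 0 \<Longrightarrow> j_inv (twist_curve D) = 16^3"
  by (simp add: j_inv_def disc_twist_curve c4_twist_curve power_mult_distrib flip: power_mult)

context imag_quad_prime
begin

text \<open>Scaling by \<open>u\<close> turns the twist by \<open>e * u^2\<close> into the twist by
  \<open>e\<close>, whose only denominator is 4 and whose discriminant is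
  \<open>37^3 * e^6\<close>.\<close>

lemma good_reduction_unit_twist:
  assumes "D \<in> K" "u \<in> K" "u \<noteq> 0" "D = e * u^2" "U e" "2 \<notin> P" "37 \<notin> P"
  shows "good_reduction_at K P (twist_curve D)"
proof (rule good_reductionI)
  show "change_coords u 0 0 0 (twist_curve D) = (0, e, 0, - 12 * e^2, - (67 * e^3 / 4))"
    using assms(3) unfolding assms(4) twist_curve_def
    by (simp add: power_mult_distrib flip: power_mult)
  have "U 2" "U 37" using assms U_of_R by auto
  then have four: "U 4" using U_mult[of 2 2] by simp
  have "disc (twist_curve e) = disc (0, e, 0, - 12 * e^2, - (67 * e^3 / 4))"
    by (simp add: twist_curve_def)
  moreover have "U (37^3 * e^6)" using assms \<open>U 37\<close> by (intro U_mult U_power)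
  ultimately show "U (disc (0, e, 0, - 12 * e^2, - (67 * e^3 / 4)))"
    using disc_twist_curve by metis
  show "e \<in> L" "- 12 * e^2 \<in> L" "- (67 * e^3 / 4) \<in> L"
    using U_imp_L[OF assms(5)] four
    by (auto intro!: L_mult L_power L_divide L_uminus)
qed (use assms R_subset_K in auto)

text \<open>Shifting y by half of \<sigma>^3 removes the denominator 4: D^3 is \<sigma>^6 modulo 4,
  and 67 + 1 = 68 is divisible by 4. The discriminant does not change.\<close>

lemma good_reduction_above_2:
  assumes "D \<in> R" "\<sigma> \<in> R" "\<tau> \<in> R" "D = \<sigma>^2 + 4 * \<tau>" "D \<notin> P" "37 \<notin> P"
  shows "good_reduction_at K P (twist_curve D)"
proof (rule good_reductionI)
  \<comment> \<open>Here -17 is -68/4, and the bracket is (D^3 - \<sigma>^6)/4 expanded in \<sigma>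
    and \<tau>.\<close>
  let ?a6 = "- 17 * \<sigma>^6 - 67 * (3 * \<sigma>^4 * \<tau> + 12 * \<sigma>^2 * \<tau>^2 + 16 * \<tau>^3)"
  show "change_coords 1 0 0 (\<sigma>^3 / 2) (twist_curve D) = (0, D, \<sigma>^3, - 12 * D^2, ?a6)"
    unfolding assms(4) twist_curve_def
    by (simp add: field_simps) (simp add: eval_nat_numeral algebra_simps)
  have "disc (0, D, \<sigma>^3, - 12 * D^2, ?a6) = 37^3 * D^6"
    unfolding assms(4) by (simp add: Let_def) (simp add: eval_nat_numeral algebra_simps)
  moreover have "U (37^3 * D^6)" using assms by (intro U_mult U_power U_of_R) auto
  ultimately show "U (disc (0, D, \<sigma>^3, - 12 * D^2, ?a6))" by simp
  show "D \<in> L" "\<sigma>^3 \<in> L" "- 12 * D^2 \<in> L" "?a6 \<in> L"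
    using assms by (auto intro!: R_subset_L R_mult R_power R_diff R_uminus R_add)
  show "\<sigma>^3 / 2 \<in> K" using assms by (intro K_divide R_subset_K R_power) auto
qed (use R_subset_K in auto)

text \<open>The translation by $12 D$ clears denominators at $37$ because $1 + 3 \cdot 12 = 37$.\<close>
lemma good_reduction_above_37:
  assumes "m = 37 * q" "coprime 37 q" "37 \<in> P" "D = \<rho> * \<kappa>" "U \<kappa>"
  shows "good_reduction_at K P (twist_curve D)"
proof (rule good_reductionI)
  let ?q = "of_int q :: complex"
  have rho: "\<rho> \<noteq> 0" using rho_sq m(2) by auto
  have q: "?q = \<rho>^2 / 37" using assms(1) rho_sq by simp
  have "2 \<notin> P" using P_coprime[of 37 2] assms(3) by simp
  then have four: "U 4" using U_of_R[of 2] U_mult[of 2 2] by simp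
  have "?q \<notin> P" using P_coprime[of 37 q] assms(2,3) by simp
  then have Uq: "U ?q" using U_of_R by auto
  have L: "\<rho> \<in> L" "\<kappa> \<in> L" using R_subset_L U_imp_L assms(5) by auto
  \<comment> \<open>After the translation the coefficients are 37 D, 12 * 37 D^2 and 5 * 37^2 D^3 /
    4. Dividing by \<rho>^2, \<rho>^4, \<rho>^6 and using 37 = \<rho>^2 / q leaves only q and 4 in
    the denominators.\<close>
  let ?E = "(0, \<rho> * \<kappa> / ?q, 0, 12 * \<kappa>^2 / ?q, 5 * \<rho> * \<kappa>^3 / (4 * ?q^2))"
  show "change_coords \<rho> (12 * D) 0 0 (twist_curve D) = ?E"
    unfolding assms(4) q twist_curve_def using rho
    by (simp add: field_simps) (simp add: eval_nat_numeral)
  have "disc ?E = \<kappa>^6 / ?q^3"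
    unfolding q using rho by (simp add: field_simps) (simp add: eval_nat_numeral algebra_simps)
  moreover have "U (\<kappa>^6 / ?q^3)" using assms Uq by (intro U_divide U_power)
  ultimately show "U (disc ?E)" by simp
  show "\<rho> * \<kappa> / ?q \<in> L" "12 * \<kappa>^2 / ?q \<in> L" "5 * \<rho> * \<kappa>^3 / (4 * ?q^2) \<in> L"
    using L Uq four by (auto intro!: L_mult L_power L_divide U_mult U_power)
  show "12 * D \<in> K" using L unfolding assms(4)
    by (intro K_mult) (auto simp: local_ring_def R_subset_K)
  show "\<rho> \<in> K" by (simp add: R_subset_K R_rho)
  show "\<rho> \<noteq> 0" by (rule rho)
qed (use R_subset_K in auto)

end

section \<open>Choice of the twist and good reduction at all primes\<close>

context imag_quad_field
begin

text \<open>A prime containing both \<open>D\<close> and its conjugate \<open>D'\<close> divides $74$, by primitivity; elsewhere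
  one of the two is a unit, and $D = (37 / D') w^2$.\<close>
lemma everywhere_good_twist:
  assumes m37: "m = 37 * q" and cop: "coprime 37 q" "coprime 37 y" "coprime x (q * y)"
    and c: "c = 1 \<or> c = 2" and D: "D \<in> R" "D' \<in> R"
    and cD: "of_int c * D = 37 * of_int x + of_int y * \<rho>"
    and cD': "of_int c * D' = 37 * of_int x - of_int y * \<rho>"
    and norm: "D * D' = 37 * of_int w ^ 2" and "odd w"
    and sq: "\<sigma> \<in> R" "\<tau> \<in> R" "D = \<sigma>^2 + 4 * \<tau>"
  shows "everywhere_good_reduction K (twist_curve D)"
  unfolding everywhere_good_reduction_def
proof (intro allI impI)
  fix P assume "prime_of K P"
  then interpret imag_quad_prime m P by unfold_locales
  have m_eq: "of_int m = (37 * of_int q :: complex)" using m37 by simp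
  have w: "of_int w \<noteq> (0 :: complex)" using \<open>odd w\<close> by auto
  have "D \<noteq> 0" "D' \<noteq> 0" using norm w by auto
  consider "2 \<in> P" | "37 \<in> P" | "2 \<notin> P" "37 \<notin> P" by blast
  then show "good_reduction_at K P (twist_curve D)"
  proof cases
    case 1
    \<comment> \<open>The norm of \<open>D\<close> is odd, so its divisor \<open>D\<close> is a unit
      above 2.\<close>
    have "of_int (37 * w^2) \<notin> P" using P_coprime[of 2 "37 * w^2"] 1 \<open>odd w\<close> by simp
    then have "D \<notin> P" using P_mult[OF D(2), of D] norm by (auto simp: mult.commute)
    moreover have "37 \<notin> P" using P_coprime[of 2 37] 1 by simp
    ultimately show ?thesis using D sq by (intro good_reduction_above_2)
  next
    case 2
    have rho_P: "\<rho> \<in> P"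
    proof -
      have "\<rho> * \<rho> = of_int q * 37" using rho_mult m37 by simp
      then show ?thesis using P_prime[OF R_rho R_rho] P_mult[OF R_of_int 2] by auto
    qed
    have "of_int (c * q) \<notin> P"
      using P_coprime[of 37 "c * q"] 2 cop c by auto
    then have "U (of_int (c * q))" by (intro U_of_R R_of_int)
    \<comment> \<open>Up to the unit \<open>c * q\<close>, this is the cofactor of \<rho> in
      \<open>D\<close>, because 37 q = \<rho>^2. Modulo \<open>P\<close>, which contains \<rho>, it
      reduces to \<open>q * y\<close>, and that is prime to 37.\<close>
    moreover have "U (of_int (q * y) + of_int x * \<rho>)"
    proof (rule U_of_R)
      show "of_int (q * y) + of_int x * \<rho> \<in> R" by (intro R_add R_mult R_of_int R_rho)
      have "of_int (q * y) \<notin> P" using P_coprime[of 37 "q * y"] 2 cop by simp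
      then show "of_int (q * y) + of_int x * \<rho> \<notin> P"
        using P_diff[OF _ P_mult[OF R_of_int rho_P], of "of_int (q * y) + of_int x * \<rho>" x] by auto
    qed
    ultimately have "U ((of_int (q * y) + of_int x * \<rho>) / of_int (c * q))" by (rule U_divide[rotated])
    moreover have "D = \<rho> * ((of_int (q * y) + of_int x * \<rho>) / of_int (c * q))"
    proof -
      have "of_int (c * q) \<noteq> (0 :: complex)" using m37 m(2) c by auto
      moreover have "of_int (c * q) * D = \<rho> * (of_int (q * y) + of_int x * \<rho>)"
        using arg_cong[OF cD, of "\<lambda>x. of_int q * x"] m_eq by (simp add: algebra_simps rho_mult)
      ultimately show ?thesis by (simp add: field_simps)
    qed
    ultimately show ?thesis using m37 cop(1) 2 by (intro good_reduction_above_37)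
  next
    case 3
    show ?thesis
    proof (cases "D \<in> P")
      case False
      then show ?thesis
        using good_reduction_unit_twist[of D 1 D] 3 D R_subset_K U_of_R by auto
    next
      case True
      have "D' \<notin> P"
      proof
        assume "D' \<in> P"
        have "of_int c * (D + D') = 2 * (37 * of_int x)"
          using cD cD' by (simp add: algebra_simps)
        then have "2 * (37 * of_int x) \<in> P" using P_mult[OF R_of_int P_add[OF True \<open>D' \<in> P\<close>]] by metis
        then have x: "of_int x \<in> P" using P_prime 3 by (meson R_of_int R_simps R_mult)
        \<comment> \<open>The factor \<rho> turns y\<rho> into \<open>37 * (q * y)\<close>, so that
          \<open>P\<close> contains the coprime integers \<open>x\<close> and
          \<open>q * y\<close>.\<close>
        have "\<rho> * (of_int c * (D - D')) = 2 * (37 * of_int (q * y))"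
        proof -
          have "of_int c * (D - D') = 2 * (of_int y * \<rho>)"
            using cD cD' by (simp add: algebra_simps)
          then show ?thesis using m_eq by (simp add: algebra_simps rho_mult)
        qed
        then have "2 * (37 * of_int (q * y)) \<in> P"
          using P_mult[OF R_rho P_mult[OF R_of_int P_diff[OF True \<open>D' \<in> P\<close>]]] by metis
        then have "of_int (q * y) \<in> P" using P_prime 3 by (meson R_of_int R_simps R_mult)
        then show False using P_coprime[OF cop(3) x] by simp
      qed
      then have "U (37 / D')" using 3 D by (intro U_divide U_of_R) auto
      moreover have "D = 37 / D' * of_int w ^ 2" using norm \<open>D' \<noteq> 0\<close> by (simp add: field_simps)
      ultimately show ?thesis
        using good_reduction_unit_twist[of D "of_int w" "37 / D'"] 3 D(1) w R_subset_K R_of_int by blast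
    qed
  qed
qed

text \<open>For \<open>y\<close> even, 37x + y\<rho> serves itself. For \<open>y\<close> odd,
  \<open>z\<close> is twice an odd \<open>w\<close>, and half of that element is an integer of norm
  \<open>37 * w^2\<close>. Negating \<open>x\<close> and \<open>y\<close> supplies the sign needed
  modulo 4.\<close>

lemma good_twist_exists:
  assumes m37: "m = 37 * q" and q: "[q = 1] (mod 8)"
    and eq: "37 * x^2 - q * y^2 = z^2"
    and cop: "coprime 37 q" "coprime 37 y" "coprime x (q * y)"
  shows "\<exists>D \<in> R. D \<noteq> 0 \<and> everywhere_good_reduction K (twist_curve D)"
proof -
  note good = everywhere_good_twist[OF m37 cop(1)]
  have m_eq: "of_int m = (37 * of_int q :: complex)" using m37 by simp
  have par: "odd x" "even y \<and> odd z \<or> odd y \<and> (\<exists>w. odd w \<and> z = 2 * w)"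
    using solution_parity[OF eq q cop(3)] by blast+
  have normc: "(37 * of_int x + of_int y * \<rho>) * (37 * of_int x - of_int y * \<rho>) = 37 * of_int z ^ 2"
    if "37 * x^2 - q * y^2 = z^2" for x y z
  proof -
    have "(37 * of_int x + of_int y * \<rho>) * (37 * of_int x - of_int y * \<rho>) = 37 * of_int (37 * x^2 - q * y^2)"
      using m_eq by (simp add: algebra_simps power2_eq_square rho_mult)
    then show ?thesis using that by simp
  qed
  show ?thesis
  proof (cases "even y")
    case True
    have *: ?thesis if "37 * x^2 - q * y^2 = z^2" "coprime 37 y" "coprime x (q * y)"
      "odd z" "even y" and sign: "[37 * x - y = 1] (mod 4)" for x y
    proof -
      obtain v where v: "y = 2 * v" using \<open>even y\<close> by blast
      obtain k where k: "37 * x - y = 4 * k + 1" using sign by (rule cong_int_obtain)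
      let ?D = "37 * of_int x + of_int y * \<rho>" and ?D' = "37 * of_int x - of_int y * \<rho>"
      have "of_int (37 * x - y) = (of_int (4 * k + 1) :: complex)" using k by simp
      \<comment> \<open>From \<rho> = 2\<omega> - 1 the element is 37x - y + 2y\<omega>, and
        \<open>2 * y\<close> is divisible by 4; so it is 1 modulo 4 and \<sigma> = 1 works.\<close>
      then have D: "?D = 1^2 + 4 * (of_int k + of_int v * \<omega>)"
        unfolding omega_def v by (simp add: field_simps)
      have "everywhere_good_reduction K (twist_curve ?D)"
      proof (rule good[OF that(2,3), where c = 1 and D = ?D and D' = ?D'
            and \<sigma> = 1 and \<tau> = "of_int k + of_int v * \<omega>"])
        show "(1::int) = 1 \<or> (1::int) = 2" by simp
        show "?D \<in> R" "?D' \<in> R" "1 \<in> R" "of_int k + of_int v * \<omega> \<in> R"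
          by (intro R_add R_diff R_mult R_of_int R_rho R_omega R_simps)+
        show "of_int 1 * ?D = 37 * of_int x + of_int y * \<rho>"
          and "of_int 1 * ?D' = 37 * of_int x - of_int y * \<rho>" by simp_all
        show "?D * ?D' = 37 * of_int z ^ 2" by (rule normc[OF that(1)])
      qed (rule that D)+
      moreover have "?D \<noteq> 0" using normc[OF that(1)] \<open>odd z\<close> by auto
      moreover have "?D \<in> R" by (intro R_add R_mult R_of_int R_rho R_simps)
      ultimately show ?thesis by blast
    qed
    have "[37 * x - y = 1] (mod 4) \<or> [37 * (- x) - (- y) = 1] (mod 4)"
      using odd_cong_mod_4(1)[of "37 * x - y"] par(1) True by simp
    then show ?thesis
      using *[of x y] *[of "-x" "-y"] eq cop par True by auto
  next
    case False
    then obtain w where w: "odd w" "z = 2 * w" using par by blast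
    have *: ?thesis if eq: "37 * x^2 - q * y^2 = (2 * w)^2" and cop: "coprime 37 y" "coprime x (q * y)"
      and "odd y" and sign: "[37 * x = 3] (mod 4)" for x y
    proof -
      define D where "D = (37 * of_int x + of_int y * \<rho>) / 2"
      define D' where "D' = (37 * of_int x - of_int y * \<rho>) / 2"
      obtain k where "37 * x = 4 * k + 3" using sign by (rule cong_int_obtain)
      then have "even (37 * x - y)" using \<open>odd y\<close> by simp
      then obtain i where i: "37 * x - y = 2 * i" by blast
      have i': "of_int (37 * x - y) = (of_int (2 * i) :: complex)" using i by simp
      have D: "D = of_int i + of_int y * \<omega>" "D' = of_int (i + y) - of_int y * \<omega>"
        unfolding D_def D'_def omega_def using i' by (simp_all add: field_simps)
      have R: "D \<in> R" "D' \<in> R" unfolding D by (intro R_add R_diff R_mult R_of_int R_omega)+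
      have norm: "D * D' = 37 * of_int w ^ 2"
        using normc[OF eq] unfolding D_def D'_def by (simp add: field_simps)
      \<comment> \<open>Trace and norm of \<open>D\<close>. Since
        \<open>D^3 = (t^2 - n) * D - t * n\<close>, the divisibility of \<open>t^2 - n\<close> and
        \<open>t * n + 1\<close> by 4 makes \<open>D^3\<close> equal to 1 modulo 4; \<open>f\<close>
        and \<open>g\<close> are the quotients.\<close>
      define t n where "t = 37 * x" and "n = 37 * w^2"
      have "[t^2 = 3^2] (mod 4)" using sign unfolding t_def by (rule cong_pow)
      moreover have n1: "[n = 1] (mod 4)"
      proof -
        obtain v where "w = 2 * v + 1" using w(1) by (elim oddE)
        then have "n = 4 * (37 * (v^2 + v) + 9) + 1" unfolding n_def by (simp add: power2_eq_square algebra_simps)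
        then show ?thesis by (simp add: cong_iff_dvd_diff)
      qed
      ultimately have "[t^2 - n = 3^2 - 1] (mod 4)" by (intro cong_diff)
      then have "4 dvd t^2 - n" by (simp add: cong_def mod_eq_0_iff_dvd)
      then obtain f where f: "t^2 - n = 4 * f" by blast
      have "[t * n + 1 = 3 * 1 + 1] (mod 4)" using sign n1 unfolding t_def by (intro cong_add cong_mult) auto
      then have "4 dvd t * n + 1" by (simp add: cong_def mod_eq_0_iff_dvd)
      then obtain g where g: "t * n + 1 = 4 * g" by blast
      \<comment> \<open>From trace $t \equiv -1$ and norm $n \equiv 1$ modulo $4$ we get $D^3 \equiv 1$,
        hence $D \equiv D^4$ is a square modulo $4$.\<close>
      have "D^2 = of_int t * D - of_int n"
      proof -
        have "D + D' = of_int t" unfolding D_def D'_def t_def by (simp add: field_simps)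
        then have "D' = of_int t - D" by (simp add: algebra_simps)
        then have "D * (of_int t - D) = of_int n" using norm unfolding n_def by simp
        then show ?thesis by (simp add: algebra_simps power2_eq_square)
      qed
      then have D2: "D * D = of_int t * D - of_int n" by (simp add: power2_eq_square)
      have "D * (D * D) = of_int t * (D * D) - of_int n * D"
        by (subst D2) (simp add: algebra_simps)
      also have "\<dots> = of_int (t^2 - n) * D - of_int (t * n)"
        by (subst D2) (simp add: algebra_simps power2_eq_square)
      finally have D3: "D * (D * D) = of_int (t^2 - n) * D - of_int (t * n)" .
      have "(D^2)^2 = D * (D * (D * D))" by (simp add: power2_eq_square)
      also have "\<dots> = D * (of_int (t^2 - n) * D - of_int (t * n))" unfolding D3 ..
      also have "\<dots> = D + of_int (t^2 - n) * D^2 - of_int (t * n + 1) * D"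
        by (simp add: algebra_simps power2_eq_square)
      also have "\<dots> = D + 4 * (of_int f * D^2 - of_int g * D)"
        unfolding f g by (simp add: algebra_simps)
      finally have sq: "D = (D^2)^2 + 4 * (of_int g * D - of_int f * D^2)" by (simp add: algebra_simps)
      have "everywhere_good_reduction K (twist_curve D)"
      proof (rule good[OF cop, where c = 2 and D = D and D' = D'
            and \<sigma> = "D^2" and \<tau> = "of_int g * D - of_int f * D^2"])
        show "(2::int) = 1 \<or> (2::int) = 2" by simp
        show "D^2 \<in> R" "of_int g * D - of_int f * D^2 \<in> R"
          by (intro R_diff R_mult R_power R_of_int R(1))+
        show "of_int 2 * D = 37 * of_int x + of_int y * \<rho>"
          and "of_int 2 * D' = 37 * of_int x - of_int y * \<rho>" by (simp_all add: D_def D'_def)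
      qed (rule R norm w sq)+
      moreover have "D \<noteq> 0" using norm w by auto
      ultimately show ?thesis using R by blast
    qed
    have "[37 * x = 3] (mod 4) \<or> [37 * (- x) = 3] (mod 4)"
      using odd_cong_mod_4(2)[of "37 * x"] par(1) by simp
    then show ?thesis
      using *[of x y] *[of "-x" "-y"] eq cop w False by auto
  qed
qed

end

theorem theorem1p4:
  fixes S :: "int set" and q m :: int
  assumes "finite S"
    and "\<forall>p\<in>S. prime p"
    and "\<forall>p\<in>S. Legendre p 37 = 1"
    and "q = - (\<Prod>p\<in>S. p)"
    and "[q = 1] (mod 8)"
    and "m = 37 * q"
  shows "\<exists>E. elliptic_over (quad_field m) E \<and> everywhere_good_reduction (quad_field m) E
              \<and> j_inv E = 16^3"
proof -
  obtain x y z where sol: "37 * x^2 - q * y^2 = z^2" "coprime x (q * y)" "coprime 37 y"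
      "coprime 37 q" "q < 0" "squarefree q"
    using ternary_37[OF assms(1-5)] by blast
  interpret imag_quad_field m
  proof
    have "squarefree (37 :: int)" by (intro squarefree_prime) simp
    then show "squarefree m" using sol assms(6) by (auto intro: squarefree_mult_coprime)
    show "m < 0" using sol assms(6) by simp
    obtain k where "q = 8 * k + 1" using assms(5) by (rule cong_int_obtain)
    then have "m - 1 = 4 * (74 * k + 9)" using assms(6) by simp
    then show "[m = 1] (mod 4)" unfolding cong_iff_dvd_diff by simp
  qed
  obtain D where D: "D \<in> R" "D \<noteq> 0" "everywhere_good_reduction K (twist_curve D)"
    using good_twist_exists[OF assms(6,5) sol(1,4,3,2)] by blast
  have "disc (twist_curve D) \<noteq> 0" using D(2) by (simp add: disc_twist_curve)
  then have "elliptic_over K (twist_curve D)"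
    unfolding twist_curve_def elliptic_over.simps
    by (intro conjI K_mult K_divide K_power K_uminus R_subset_K[OF D(1)]
        R_subset_K[OF R_simps(1)] R_subset_K[OF R_simps(3)])
  then show ?thesis using D j_inv_twist_curve by blast
qed

end
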